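(* Let $(\mathcal{S}, \mathcal{A}\times\mathbb{R}_{>0}, \longrightarrow)$ be an action-labeled CTMC and let $s_1, s_2 \in \mathcal{S}$. If $s_1 \sim_{\mathrm{FBMB}} s_2$ (forward and backward Markovian bisimilarity), then $s_1 \sim_{\mathrm{MB}} s_2$ (Markovian bisimilarity).
   Context: An action-labeled CTMC is a triple $(\mathcal S,\mathcal A\times\mathbb R_{>0},\longrightarrow)$ with $\mathcal S$ a set of states, $\mathcal A$ a countable set of actions, and $\longrightarrow\subseteq\mathcal S\times(\mathcal A\times\mathbb R_{>0})\times\mathcal S$ a transition relation; write $s\xrightarrow{\langle a,\lambda\rangle}s'$. For $s\in\mathcal S$, $a\in\mathcal A$, $C\subseteq\mathcal S$, let $\mathrm{rate}(s,a,C)$ be the sum of the multiset $\{\!|\lambda \mid \exists s'\in C.\ s\xrightarrow{\langle a,\lambda\rangle}s'|\!\}$. An equivalence relation $\mathcal B$ on $\mathcal S$ is a Markovian bisimulation iff whenever $(s_1,s_2)\in\mathcal B$, $\mathrm{rate}(s_1,a,C)=\mathrm{rate}(s_2,a,C)$ for all $a\in\mathcal A$ and $C\in\mathcal S/\mathcal B$; $s_1\sim_{\mathrm{MB}}s_2$ iff some Markovian bisimulation contains $(s_1,s_2)$. A path of length $n$ from $s_0$ is a sequence $\xi=(s_0,\langle a_1,\lambda_1\rangle,s_1)\dots(s_{n-1},\langle a_n,\lambda_n\rangle,s_n)$ of transitions ($\epsilon$ the empty path); $\mathrm{last}(\xi)=s_n$. A run from $s$ is a pair $\rho=(s,\xi)$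 with $\xi$ a path from $s$ (possibly $\epsilon$); $\mathrm{last}(\rho)=\mathrm{last}(\xi)$, and $\mathrm{last}(\rho)=s$ if $\xi=\epsilon$. $\mathcal U$ denotes the set of all runs. Write $\rho\xrightarrow{\langle a,\lambda\rangle}\rho'$ iff $\rho'=(s,\xi\,(\mathrm{last}(\rho),\langle a,\lambda\rangle,s'))$ where $\rho=(s,\xi)$ and $\mathrm{last}(\rho)\xrightarrow{\langle a,\lambda\rangle}s'$. For $\rho\in\mathcal U$, $a\in\mathcal A$, $C\subseteq\mathcal U$: $\mathrm{rate}_o(\rho,a,C)$ is the sum of the multiset $\{\!|\lambda\mid\exists\rho'\in C.\ \rho\xrightarrow{\langle a,\lambda\rangle}\rho'|\!\}$ and $\mathrm{rate}_i(\rho,a,C)$ is the sum of the multiset $\{\!|\lambda\mid\exists\rho'\in C.\ \rho'\xrightarrow{\langle a,\lambda\rangle}\rho|\!\}$. An equivalence relation $\mathcal B$ on $\mathcal U$ is a forward and backward Markovian bisimulation iff whenever $(\rho_1,\rho_2)\in\mathcal B$, for all $a\in\mathcal A$ and $C\in\mathcal U/\mathcal B$: $\mathrm{rate}_o(\rho_1,a,C)=\mathrm{rate}_o(\rho_2,a,C)$ and $\mathrm{rate}_i(\rho_1,a,C)=\mathrm{rate}_i(\rho_2,a,C)$. $s_1\sim_{\mathrm{FBMB}}s_2$ iff some such bisimulation contains $((s_1,\epsilon),(s_2,\epsilon))$. *)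

theory Defs
  imports "HOL-Analysis.Analysis"
begin

definition action_labeled_ctmc :: "'s set \<Rightarrow> 'a set \<Rightarrow> ('s \<times> ('a \<times> real) \<times> 's) set \<Rightarrow> bool" where
  "action_labeled_ctmc S A T \<longleftrightarrow> countable A \<and> T \<subseteq> S \<times> (A \<times> {0<..}) \<times> S"

text \<open>The multiset of rates has one occurrence of \<open>l\<close> for each transition, so the sum ranges over
  pairs of a rate and a target (or source) state. No finiteness of branching is assumed; the sum is
  taken in \<^typ>\<open>ennreal\<close>, where a divergent sum has the value \<open>\<infinity>\<close>
  (over \<^typ>\<open>real\<close> it would be \<open>0\<close>).\<close>

definition rate :: "('s \<times> ('a \<times> real) \<times> 's) set \<Rightarrow> 's \<Rightarrow> 'a \<Rightarrow> 's set \<Rightarrow> ennreal" where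
  "rate T s a C = infsum (\<lambda>(l, s'). ennreal l) {(l, s'). s' \<in> C \<and> (s, (a, l), s') \<in> T}"

definition markovian_bisimulation ::
  "'s set \<Rightarrow> 'a set \<Rightarrow> ('s \<times> ('a \<times> real) \<times> 's) set \<Rightarrow> ('s \<times> 's) set \<Rightarrow> bool" where
  "markovian_bisimulation S A T B \<longleftrightarrow>
     equiv S B \<and>
     (\<forall>(s\<^sub>1, s\<^sub>2) \<in> B. \<forall>a \<in> A. \<forall>C \<in> S // B. rate T s\<^sub>1 a C = rate T s\<^sub>2 a C)"

definition markovian_bisimilar ::
  "'s set \<Rightarrow> 'a set \<Rightarrow> ('s \<times> ('a \<times> real) \<times> 's) set \<Rightarrow> 's \<Rightarrow> 's \<Rightarrow> bool" where
  "markovian_bisimilar S A T s\<^sub>1 s\<^sub>2 \<longleftrightarrow>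
     (\<exists>B. markovian_bisimulation S A T B \<and> (s\<^sub>1, s\<^sub>2) \<in> B)"

type_synonym ('s, 'a) run = "'s \<times> ('s \<times> ('a \<times> real) \<times> 's) list"

fun path_from :: "('s \<times> ('a \<times> real) \<times> 's) set \<Rightarrow> 's \<Rightarrow> ('s \<times> ('a \<times> real) \<times> 's) list \<Rightarrow> bool" where
  "path_from T s [] \<longleftrightarrow> True"
| "path_from T s ((p, l, q) # \<xi>) \<longleftrightarrow> p = s \<and> (p, l, q) \<in> T \<and> path_from T q \<xi>"

definition runs :: "'s set \<Rightarrow> ('s \<times> ('a \<times> real) \<times> 's) set \<Rightarrow> ('s, 'a) run set" where
  "runs S T = {(s, \<xi>). s \<in> S \<and> path_from T s \<xi>}"

definition last_state :: "('s, 'a) run \<Rightarrow> 's" where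
  "last_state \<rho> = (case \<rho> of (s, \<xi>) \<Rightarrow> if \<xi> = [] then s else snd (snd (last \<xi>)))"

definition run_trans ::
  "'s set \<Rightarrow> ('s \<times> ('a \<times> real) \<times> 's) set \<Rightarrow> (('s, 'a) run \<times> ('a \<times> real) \<times> ('s, 'a) run) set" where
  "run_trans S T =
     {(\<rho>, (a, l), \<rho>'). \<rho> \<in> runs S T \<and>
        (\<exists>s'. (last_state \<rho>, (a, l), s') \<in> T \<and>
              \<rho>' = (fst \<rho>, snd \<rho> @ [(last_state \<rho>, (a, l), s')]))}"

definition rate_o ::
  "'s set \<Rightarrow> ('s \<times> ('a \<times> real) \<times> 's) set \<Rightarrow> ('s, 'a) run \<Rightarrow> 'a \<Rightarrow> ('s, 'a) run set \<Rightarrow> ennreal" where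
  "rate_o S T \<rho> a C =
     infsum (\<lambda>(l, \<rho>'). ennreal l) {(l, \<rho>'). \<rho>' \<in> C \<and> (\<rho>, (a, l), \<rho>') \<in> run_trans S T}"

definition rate_i ::
  "'s set \<Rightarrow> ('s \<times> ('a \<times> real) \<times> 's) set \<Rightarrow> ('s, 'a) run \<Rightarrow> 'a \<Rightarrow> ('s, 'a) run set \<Rightarrow> ennreal" where
  "rate_i S T \<rho> a C =
     infsum (\<lambda>(l, \<rho>'). ennreal l) {(l, \<rho>'). \<rho>' \<in> C \<and> (\<rho>', (a, l), \<rho>) \<in> run_trans S T}"

definition fb_markovian_bisimulation ::
  "'s set \<Rightarrow> 'a set \<Rightarrow> ('s \<times> ('a \<times> real) \<times> 's) set \<Rightarrow> (('s, 'a) run \<times> ('s, 'a) run) set \<Rightarrow> bool" where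
  "fb_markovian_bisimulation S A T B \<longleftrightarrow>
     equiv (runs S T) B \<and>
     (\<forall>(\<rho>\<^sub>1, \<rho>\<^sub>2) \<in> B. \<forall>a \<in> A. \<forall>C \<in> runs S T // B.
        rate_o S T \<rho>\<^sub>1 a C = rate_o S T \<rho>\<^sub>2 a C \<and>
        rate_i S T \<rho>\<^sub>1 a C = rate_i S T \<rho>\<^sub>2 a C)"

definition fb_markovian_bisimilar ::
  "'s set \<Rightarrow> 'a set \<Rightarrow> ('s \<times> ('a \<times> real) \<times> 's) set \<Rightarrow> 's \<Rightarrow> 's \<Rightarrow> bool" where
  "fb_markovian_bisimilar S A T s\<^sub>1 s\<^sub>2 \<longleftrightarrow>
     (\<exists>B. fb_markovian_bisimulation S A T B \<and> ((s\<^sub>1, []), (s\<^sub>2, [])) \<in> B)"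

end

theory Submission
  imports Defs
begin

text \<open>Let \<open>B\<close> be a forward and backward bisimulation, and let \<open>R\<close> be the transitive closure of the
  image of \<open>B\<close> under \<^const>\<open>last_state\<close>. For an \<open>R\<close>-class \<open>C\<close>, the set of runs ending in \<open>C\<close> is a
  union of \<open>B\<close>-classes, and the rate from \<open>last_state \<rho>\<close> into \<open>C\<close> is the outgoing rate from \<open>\<rho>\<close> into
  that set. Summing over the \<open>B\<close>-classes shows that this rate depends only on the \<open>B\<close>-class of
  \<open>\<rho>\<close>, so \<open>R\<close> is a Markovian bisimulation.\<close>

text \<open>The library fact named \<open>summable_on_ennreal\<close> covers only sums of \<open>ennreal_of_enat\<close>.\<close>

lemma ennreal_summable_on [simp]: "f summable_on X" for f :: "'b \<Rightarrow> ennreal"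
  by (simp add: nonneg_summable_on_complete)

text \<open>In \<open>ennreal\<close> it suffices to bound the finite partial sums. A finite
  \<open>F\<close> meets only finitely many fibres of \<open>k\<close>, so finite additivity over
  the fibres of \<open>m\<close> is enough and no sum over infinitely many classes is ever
  formed.\<close>

lemma infsum_ennreal_le_by_fibres:
  fixes f :: "'b \<Rightarrow> ennreal" and g :: "'c \<Rightarrow> ennreal"
  assumes le: "\<And>c. c \<in> k ` X \<Longrightarrow> infsum f {x \<in> X. k x = c} \<le> infsum g {y \<in> Y. m y = c}"
  shows "infsum f X \<le> infsum g Y"
proof (rule infsum_le_finite_sums)
  fix F assume F: "finite F" "F \<subseteq> X"
  have union: "(\<Sum>c\<in>K. infsum g {y \<in> Y. m y = c}) = infsum g {y \<in> Y. m y \<in> K}"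
    if "finite K" for K
    using that
  proof (induction K rule: finite_induct)
    case (insert c K)
    have insert_eq: "{y \<in> Y. m y \<in> insert c K} = {y \<in> Y. m y = c} \<union> {y \<in> Y. m y \<in> K}"
      by auto
    have disj: "{y \<in> Y. m y = c} \<inter> {y \<in> Y. m y \<in> K} = {}"
      using insert.hyps by auto
    have "infsum g {y \<in> Y. m y \<in> insert c K} =
        infsum g {y \<in> Y. m y = c} + infsum g {y \<in> Y. m y \<in> K}"
      unfolding insert_eq
      by (rule infsum_Un_disjoint[OF ennreal_summable_on ennreal_summable_on disj])
    then show ?case
      by (simp only: sum.insert[OF insert.hyps] insert.IH)
  qed simp
  have "sum f F = (\<Sum>c\<in>k ` F. sum f {x \<in> F. k x = c})"
    using F(1) by (rule sum.image_gen)
  also have "\<dots> \<le> (\<Sum>c\<in>k ` F. infsum g {y \<in> Y. m y = c})"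
  proof (rule sum_mono)
    fix c assume c: "c \<in> k ` F"
    have "sum f {x \<in> F. k x = c} = infsum f {x \<in> F. k x = c}"
      using F(1) by simp
    \<comment> \<open>Enlarging the index set cannot decrease a sum of nonnegative terms; the same
      holds for the last step, from finitely many fibres to all of \<open>Y\<close>.\<close>
    also have "\<dots> \<le> infsum f {x \<in> X. k x = c}"
      by (rule infsum_mono_neutral) (use F(2) in auto)
    also have "\<dots> \<le> infsum g {y \<in> Y. m y = c}"
      using c F(2) by (intro le) auto
    finally show "sum f {x \<in> F. k x = c} \<le> infsum g {y \<in> Y. m y = c}" .
  qed
  also have "\<dots> = infsum g {y \<in> Y. m y \<in> k ` F}"
    using F(1) by (simp add: union)
  also have "\<dots> \<le> infsum g Y"
    by (rule infsum_mono_neutral) auto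
  finally show "sum f F \<le> infsum g Y" .
qed (rule ennreal_summable_on)

lemma last_state_Nil [simp]: "last_state (s, []) = s"
  by (simp add: last_state_def)

lemma last_state_Cons [simp]: "last_state (s, (p, l, q) # \<xi>) = last_state (q, \<xi>)"
  by (simp add: last_state_def)

text \<open>Bridges two directions: \<open>path_from\<close> recurses at the head of the path, while
  \<open>run_trans\<close> extends it at the end.\<close>

lemma path_from_snoc:
  "path_from T s (\<xi> @ [(p, l, q)]) \<longleftrightarrow>
     path_from T s \<xi> \<and> p = last_state (s, \<xi>) \<and> (p, l, q) \<in> T"
proof (induction \<xi> arbitrary: s)
  case Nil
  then show ?case
    by auto
next
  case (Cons x \<xi>)
  obtain p' l' q' where "x = (p', l', q')"
    by (cases x)
  then show ?case
    using Cons.IH[of q'] by (simp only: append_Cons path_from.simps last_state_Cons) blast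
qed

lemma last_state_in_states:
  assumes "action_labeled_ctmc S A T" "\<rho> \<in> runs S T"
  shows "last_state \<rho> \<in> S"
proof -
  have target: "q \<in> S" if "(p, l, q) \<in> T" for p l q
    using assms(1) that by (auto simp: action_labeled_ctmc_def)
  have "path_from T s \<xi> \<Longrightarrow> s \<in> S \<Longrightarrow> last_state (s, \<xi>) \<in> S" for s \<xi>
  proof (induction \<xi> arbitrary: s)
    case (Cons x \<xi>)
    obtain p l q where x: "x = (p, l, q)"
      by (cases x)
    have "q \<in> S"
      using Cons.prems x target[of p l q] by auto
    then have "last_state (q, \<xi>) \<in> S"
      using Cons x by simp
    then show ?case
      by (simp add: x)
  qed simp
  then show ?thesis
    using assms(2) by (auto simp: runs_def)
qed

lemma run_trans_target:
  assumes "(\<rho>, (a, l), \<rho>') \<in> run_trans S T"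
  shows "\<rho>' \<in> runs S T"
proof -
  from assms obtain s' where "\<rho> \<in> runs S T" "(last_state \<rho>, (a, l), s') \<in> T"
    and \<rho>': "\<rho>' = (fst \<rho>, snd \<rho> @ [(last_state \<rho>, (a, l), s')])"
    unfolding run_trans_def by blast
  then show ?thesis
    unfolding \<rho>' by (cases \<rho>) (simp add: runs_def path_from_snoc)
qed

text \<open>The appended triple records both the rate and the target, so appending it to \<rho> is a
  rate-preserving bijection from the transitions of the last state to those of the run.\<close>

lemma rate_last_state:
  assumes "\<rho> \<in> runs S T"
  shows "rate T (last_state \<rho>) a C = rate_o S T \<rho> a {\<rho>'. last_state \<rho>' \<in> C}"
proof -
  let ?ext = "\<lambda>(l, s'). (l, (fst \<rho>, snd \<rho> @ [(last_state \<rho>, (a, l), s')]))"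
  let ?X = "{(l, s'). s' \<in> C \<and> (last_state \<rho>, (a, l), s') \<in> T}"
  have "inj_on ?ext ?X"
    by (auto simp: inj_on_def)
  moreover have "?ext ` ?X =
      {(l, \<rho>'). \<rho>' \<in> {\<rho>'. last_state \<rho>' \<in> C} \<and> (\<rho>, (a, l), \<rho>') \<in> run_trans S T}"
    using assms by (auto simp: run_trans_def last_state_def image_iff)
  ultimately have "bij_betw ?ext ?X
      {(l, \<rho>'). \<rho>' \<in> {\<rho>'. last_state \<rho>' \<in> C} \<and> (\<rho>, (a, l), \<rho>') \<in> run_trans S T}"
    by (simp add: bij_betw_def)
  from infsum_reindex_bij_betw[OF this, of "\<lambda>(l, _). ennreal l"] show ?thesis
    unfolding rate_def rate_o_def by (simp add: case_prod_unfold)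
qed

text \<open>The fibre comparison is applied with each transition sent to the \<open>B\<close>-class
  of its target. An inequality suffices, since \<open>B\<close> is symmetric and the roles of \<rho>
  and \<sigma> can be exchanged.\<close>

lemma rate_o_saturated_le:
  fixes T :: "('s \<times> ('a \<times> real) \<times> 's) set"
  assumes B: "fb_markovian_bisimulation S A T B"
    and rel: "(\<rho>, \<sigma>) \<in> B" and a: "a \<in> A"
    and sat: "\<And>\<rho>' \<sigma>'. (\<rho>', \<sigma>') \<in> B \<Longrightarrow> \<rho>' \<in> D \<Longrightarrow> \<sigma>' \<in> D"
  shows "rate_o S T \<rho> a D \<le> rate_o S T \<sigma> a D"
proof -
  have eq: "equiv (runs S T) B"
    using B by (simp add: fb_markovian_bisimulation_def)
  let ?X = "\<lambda>\<rho> D. {(l, \<rho>'). \<rho>' \<in> D \<and> (\<rho>, (a, l), \<rho>') \<in> run_trans S T}"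
  let ?k = "\<lambda>(l, \<rho>'). B `` {\<rho>'}"
  \<comment> \<open>By saturation a class that meets \<open>D\<close> lies inside \<open>D\<close>,
    so the fibre sum is the rate into a whole class, to which the bisimulation condition
    applies.\<close>
  have fibre: "{x \<in> ?X \<tau> D. ?k x = B `` {\<rho>'}} = ?X \<tau> (B `` {\<rho>'})"
    if "\<rho>' \<in> D" "\<rho>' \<in> runs S T" for \<tau> \<rho>'
  proof -
    have class_iff: "\<sigma>' \<in> D \<and> B `` {\<sigma>'} = B `` {\<rho>'} \<longleftrightarrow> \<sigma>' \<in> B `` {\<rho>'}"
      if "\<sigma>' \<in> runs S T" for \<sigma>'
    proof -
      have "B `` {\<sigma>'} = B `` {\<rho>'} \<longleftrightarrow> (\<rho>', \<sigma>') \<in> B"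
        using eq_equiv_class_iff[OF eq \<open>\<rho>' \<in> runs S T\<close> that] by metis
      then show ?thesis
        using sat[OF _ \<open>\<rho>' \<in> D\<close>, of \<sigma>'] by (simp only: Image_singleton_iff) metis
    qed
    show ?thesis
    proof (rule set_eqI)
      fix x :: "real \<times> ('s, 'a) run"
      obtain l \<sigma>' where x: "x = (l, \<sigma>')"
        by (cases x)
      have "(\<tau>, (a, l), \<sigma>') \<in> run_trans S T \<Longrightarrow> \<sigma>' \<in> runs S T"
        by (rule run_trans_target)
      then show "x \<in> {x \<in> ?X \<tau> D. ?k x = B `` {\<rho>'}} \<longleftrightarrow> x \<in> ?X \<tau> (B `` {\<rho>'})"
        using class_iff[of \<sigma>'] by (simp only: x mem_Collect_eq prod.case) blast
    qed
  qed
  show ?thesis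
    unfolding rate_o_def
  proof (rule infsum_ennreal_le_by_fibres)
    fix c assume "c \<in> ?k ` ?X \<rho> D"
    then obtain l \<rho>' where *: "c = B `` {\<rho>'}" "\<rho>' \<in> D" "(\<rho>, (a, l), \<rho>') \<in> run_trans S T"
      by auto
    then have "\<rho>' \<in> runs S T"
      by (auto dest: run_trans_target)
    moreover from this have "rate_o S T \<rho> a c = rate_o S T \<sigma> a c"
      using B rel a *(1) quotientI[of \<rho>' "runs S T" B]
      unfolding fb_markovian_bisimulation_def by blast
    ultimately show "infsum (\<lambda>(l, \<rho>'). ennreal l) {x \<in> ?X \<rho> D. ?k x = c}
        \<le> infsum (\<lambda>(l, \<rho>'). ennreal l) {x \<in> ?X \<sigma> D. ?k x = c}"
      using * by (simp only: fibre rate_o_def)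
  qed
qed

theorem theorem5p5:
  fixes S :: "'s set" and A :: "'a set"
    and T :: "('s \<times> ('a \<times> real) \<times> 's) set"
    and s\<^sub>1 s\<^sub>2 :: 's
  assumes "action_labeled_ctmc S A T"
    and "s\<^sub>1 \<in> S" and "s\<^sub>2 \<in> S"
    and "fb_markovian_bisimilar S A T s\<^sub>1 s\<^sub>2"
  shows "markovian_bisimilar S A T s\<^sub>1 s\<^sub>2"
proof -
  from assms(4) obtain B where B: "fb_markovian_bisimulation S A T B"
    and B12: "((s\<^sub>1, []), (s\<^sub>2, [])) \<in> B"
    by (auto simp: fb_markovian_bisimilar_def)
  then have eq: "equiv (runs S T) B"
    by (simp add: fb_markovian_bisimulation_def)
  \<comment> \<open>\<open>P\<close> itself may fail to be transitive: runs ending in the same state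
    can lie in different \<open>B\<close>-classes. Hence the passage to \<open>P\<^sup>+\<close>
    below.\<close>
  define P where "P = map_prod last_state last_state ` B"
  have B_runs: "B \<subseteq> runs S T \<times> runs S T"
    using eq by (rule equiv_type)
  have P_S: "P \<subseteq> S \<times> S"
    using B_runs last_state_in_states[OF assms(1)] by (auto simp: P_def)
  have "sym P"
    using eq by (force simp: P_def equiv_def sym_def)
  \<comment> \<open>Every state is the last state of its empty run.\<close>
  have refl_P: "(s, s) \<in> P" if "s \<in> S" for s
  proof -
    have "((s, []), (s, [])) \<in> B"
      using eq that by (auto simp: equiv_def runs_def refl_on_def)
    then show ?thesis
      by (force simp: P_def last_state_def)
  qed
  have equiv: "equiv S (P\<^sup>+)"
    using refl_P \<open>sym P\<close> trancl_subset_Sigma[OF P_S]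
    by (auto simp: equiv_def intro!: refl_onI sym_trancl)
  have le: "rate T (last_state \<rho>) a C \<le> rate T (last_state \<sigma>) a C"
    if "(\<rho>, \<sigma>) \<in> B" "a \<in> A" "C \<in> S // P\<^sup>+" for \<rho> \<sigma> a C
  proof -
    \<comment> \<open>This is the saturation hypothesis: \<open>P\<^sup>+\<close> contains the image
      of \<open>B\<close>, so moving within a \<open>B\<close>-class cannot take the last state out
      of \<open>C\<close>.\<close>
    have "last_state \<sigma>' \<in> C" if "(\<rho>', \<sigma>') \<in> B" "last_state \<rho>' \<in> C" for \<rho>' \<sigma>'
    proof -
      have "(last_state \<rho>', last_state \<sigma>') \<in> P\<^sup>+"
        using that(1) by (force simp: P_def)
      then show ?thesis
        using in_quotient_imp_closed[OF equiv \<open>C \<in> S // P\<^sup>+\<close>] that(2) by blast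
    qed
    then have "rate_o S T \<rho> a {\<rho>'. last_state \<rho>' \<in> C} \<le> rate_o S T \<sigma> a {\<rho>'. last_state \<rho>' \<in> C}"
      by (intro rate_o_saturated_le[OF B that(1,2)]) simp
    then show ?thesis
      using B_runs that(1) by (auto simp: rate_last_state)
  qed
  have step: "rate T s a C = rate T t a C"
    if "(s, t) \<in> P" "a \<in> A" "C \<in> S // P\<^sup>+" for s t a C
  proof -
    from that(1) obtain \<rho> \<sigma> where "(\<rho>, \<sigma>) \<in> B" "s = last_state \<rho>" "t = last_state \<sigma>"
      by (auto simp: P_def)
    moreover from this have "(\<sigma>, \<rho>) \<in> B"
      using eq by (auto simp: equiv_def dest: symD)
    ultimately show ?thesis
      using le[of \<rho> \<sigma>] le[of \<sigma> \<rho>] that(2,3) by (simp add: antisym)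
  qed
  \<comment> \<open>\<open>C\<close> stays a fixed class of \<open>P\<^sup>+\<close> along the whole
    chain, so the equalities for single \<open>P\<close>-steps compose.\<close>
  have "rate T s a C = rate T t a C"
    if "(s, t) \<in> P\<^sup>+" "a \<in> A" "C \<in> S // P\<^sup>+" for s t a C
    using that(1) by (induction rule: trancl_induct) (auto simp: step[OF _ that(2,3)])
  then have "markovian_bisimulation S A T (P\<^sup>+)"
    using equiv by (auto simp: markovian_bisimulation_def)
  moreover have "(s\<^sub>1, s\<^sub>2) \<in> P"
    using B12 by (force simp: P_def last_state_def)
  ultimately show ?thesis
    by (auto simp: markovian_bisimilar_def)
qed

end
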